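(* Let $\Gamma$ be a finite group. If a countable $\mathbb{Z}\Gamma$-module has a permutation presentation, then it has a countable permutation presentation.
   Context: All modules are left modules. A $\mathbb{Z}\Gamma$-module $F$ is a permutation module if it has a basis as a $\mathbb{Z}$-module which is permuted by the action of $\Gamma$. A permutation presentation of a $\mathbb{Z}\Gamma$-module $M$ is an exact sequence $0\to F\to F\to M\to 0$ of $\mathbb{Z}\Gamma$-modules where $F$ is a permutation $\mathbb{Z}\Gamma$-module (the same $F$ in both places); it is called countable when $F$ is a countable set. *)

theory Defs
  imports "HOL-Algebra.AbelCoset" "HOL-Algebra.Module" "HOL-Library.Poly_Mapping" "HOL-Library.Countable_Set"
begin

text \<open>
  The integral group ring of \<open>G\<close>: finite formal sums \<open>\<Sum> c\<^sub>g g\<close> with \<open>c\<^sub>g\<close> an integer and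
  \<open>g\<close> in the carrier of \<open>G\<close>, where \<open>frag_of g\<close> is the group element \<open>g\<close> itself.
  The product is the biadditive extension of the group multiplication.
\<close>

definition group_ring :: "('g, 'z) monoid_scheme \<Rightarrow> ('g \<Rightarrow>\<^sub>0 int) ring" where
  "group_ring G =
    \<lparr>carrier = {c. Poly_Mapping.keys c \<subseteq> carrier G},
     mult = (\<lambda>a b. frag_extend (\<lambda>g. frag_extend (\<lambda>h. frag_of (g \<otimes>\<^bsub>G\<^esub> h)) b) a),
     one = frag_of \<one>\<^bsub>G\<^esub>,
     zero = 0,
     add = (+)\<rparr>"

lemma ring_group_ring:
  assumes "group G"
  shows "ring (group_ring G)"
proof -
  interpret group G by fact
  let ?m = "\<lambda>a b. frag_extend (\<lambda>g. frag_extend (\<lambda>h. frag_of (g \<otimes>\<^bsub>G\<^esub> h)) b) a"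
  have add_r: "?m a (b + c) = ?m a b + ?m a c" for a b c :: "'a \<Rightarrow>\<^sub>0 int"
  proof -
    have "Poly_Mapping.keys a \<subseteq> UNIV" by simp
    then show ?thesis
      by (induction a rule: frag_induction) (simp_all add: frag_extend_add frag_extend_diff)
  qed
  have add_l: "?m (a + b) c = ?m a c + ?m b c" for a b c :: "'a \<Rightarrow>\<^sub>0 int"
    by (simp add: frag_extend_add)
  have closed: "Poly_Mapping.keys (?m a b) \<subseteq> carrier G"
    if "Poly_Mapping.keys a \<subseteq> carrier G" "Poly_Mapping.keys b \<subseteq> carrier G" for a b
    using that by (fastforce dest!: subsetD [OF keys_frag_extend])
  have assoc: "?m (?m a b) c = ?m a (?m b c)"
    if a: "Poly_Mapping.keys a \<subseteq> carrier G" and b: "Poly_Mapping.keys b \<subseteq> carrier G"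
      and c: "Poly_Mapping.keys c \<subseteq> carrier G" for a b c
    using a
  proof (induction a rule: frag_induction)
    case (one g)
    show ?case
      using b
    proof (induction b rule: frag_induction)
      case (one h)
      show ?case
        using c
        by (induction c rule: frag_induction)
           (use \<open>g \<in> carrier G\<close> \<open>h \<in> carrier G\<close> in \<open>simp_all add: frag_extend_diff m_assoc\<close>)
    qed (simp_all add: frag_extend_diff)
  qed (simp_all add: frag_extend_diff)
  have l_one: "?m (frag_of \<one>\<^bsub>G\<^esub>) a = a" if "Poly_Mapping.keys a \<subseteq> carrier G" for a
    using that by (induction a rule: frag_induction) (simp_all add: frag_extend_diff)
  have r_one: "?m a (frag_of \<one>\<^bsub>G\<^esub>) = a" if "Poly_Mapping.keys a \<subseteq> carrier G" for a
    using that by (induction a rule: frag_induction) (simp_all add: frag_extend_diff)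
  show ?thesis
  proof (rule ringI)
    show "abelian_group (group_ring G)"
    proof (rule abelian_groupI)
      fix x assume "x \<in> carrier (group_ring G)"
      then show "\<exists>y\<in>carrier (group_ring G). y \<oplus>\<^bsub>group_ring G\<^esub> x = \<zero>\<^bsub>group_ring G\<^esub>"
        by (intro bexI [of _ "- x"]) (simp_all add: group_ring_def)
    qed (auto simp: group_ring_def add_ac dest!: subsetD [OF Poly_Mapping.keys_add])
    show "monoid (group_ring G)"
      by (rule monoidI) (use closed assoc l_one r_one in \<open>auto simp: group_ring_def\<close>)
  qed (simp_all add: group_ring_def add_l add_r)
qed

text \<open>
  \<^locale>\<open>module\<close> of the library requires a commutative ring of scalars, which a group ring is not
  in general; these are its axioms over an arbitrary ring.
\<close>

locale left_module = R?: ring + M?: abelian_group M for M (structure) +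
  assumes smult_closed:
      "\<lbrakk>a \<in> carrier R; x \<in> carrier M\<rbrakk> \<Longrightarrow> a \<odot>\<^bsub>M\<^esub> x \<in> carrier M"
    and smult_l_distr:
      "\<lbrakk>a \<in> carrier R; b \<in> carrier R; x \<in> carrier M\<rbrakk> \<Longrightarrow>
        (a \<oplus> b) \<odot>\<^bsub>M\<^esub> x = a \<odot>\<^bsub>M\<^esub> x \<oplus>\<^bsub>M\<^esub> b \<odot>\<^bsub>M\<^esub> x"
    and smult_r_distr:
      "\<lbrakk>a \<in> carrier R; x \<in> carrier M; y \<in> carrier M\<rbrakk> \<Longrightarrow>
        a \<odot>\<^bsub>M\<^esub> (x \<oplus>\<^bsub>M\<^esub> y) = a \<odot>\<^bsub>M\<^esub> x \<oplus>\<^bsub>M\<^esub> a \<odot>\<^bsub>M\<^esub> y"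
    and smult_assoc:
      "\<lbrakk>a \<in> carrier R; b \<in> carrier R; x \<in> carrier M\<rbrakk> \<Longrightarrow>
        (a \<otimes> b) \<odot>\<^bsub>M\<^esub> x = a \<odot>\<^bsub>M\<^esub> (b \<odot>\<^bsub>M\<^esub> x)"
    and smult_one:
      "x \<in> carrier M \<Longrightarrow> \<one> \<odot>\<^bsub>M\<^esub> x = x"

definition left_module_hom ::
  "('r, 'z) ring_scheme \<Rightarrow> ('r, 'm, 'y) module_scheme \<Rightarrow> ('r, 'n, 'x) module_scheme \<Rightarrow> ('m \<Rightarrow> 'n) set"
where
  "left_module_hom R M N =
    {f. f \<in> carrier M \<rightarrow> carrier N \<and>
        (\<forall>x\<in>carrier M. \<forall>y\<in>carrier M. f (x \<oplus>\<^bsub>M\<^esub> y) = f x \<oplus>\<^bsub>N\<^esub> f y) \<and>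
        (\<forall>a\<in>carrier R. \<forall>x\<in>carrier M. f (a \<odot>\<^bsub>M\<^esub> x) = a \<odot>\<^bsub>N\<^esub> f x)}"

text \<open>\<open>c\<close> is the family of coefficients; it has finite support \<open>keys c\<close>.\<close>

definition int_comb :: "('m, 'z) ring_scheme \<Rightarrow> ('m \<Rightarrow>\<^sub>0 int) \<Rightarrow> 'm" where
  "int_comb A c = (\<Oplus>\<^bsub>A\<^esub>b\<in>Poly_Mapping.keys c. [Poly_Mapping.lookup c b] \<cdot>\<^bsub>A\<^esub> b)"

definition int_basis :: "('m, 'z) ring_scheme \<Rightarrow> 'm set \<Rightarrow> bool" where
  "int_basis A B \<longleftrightarrow>
    B \<subseteq> carrier A \<and>
    (\<forall>x\<in>carrier A. \<exists>c. Poly_Mapping.keys c \<subseteq> B \<and> x = int_comb A c) \<and>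
    (\<forall>c. Poly_Mapping.keys c \<subseteq> B \<and> int_comb A c = \<zero>\<^bsub>A\<^esub> \<longrightarrow> c = 0)"

definition permutation_module ::
  "('g, 'z) monoid_scheme \<Rightarrow> ('g \<Rightarrow>\<^sub>0 int, 'm, 'y) module_scheme \<Rightarrow> bool" where
  "permutation_module G F \<longleftrightarrow>
    left_module (group_ring G) F \<and>
    (\<exists>B. int_basis F B \<and> (\<forall>g\<in>carrier G. bij_betw (\<lambda>b. frag_of g \<odot>\<^bsub>F\<^esub> b) B B))"

text \<open>The sequence \<open>0 \<rightarrow> F \<rightarrow> F \<rightarrow> M \<rightarrow> 0\<close> with maps \<open>i\<close> and \<open>p\<close> is exact.\<close>

definition permutation_presentation ::
  "('g, 'z) monoid_scheme \<Rightarrow> ('g \<Rightarrow>\<^sub>0 int, 'm, 'y) module_scheme \<Rightarrow>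
    ('g \<Rightarrow>\<^sub>0 int, 'f, 'x) module_scheme \<Rightarrow> ('f \<Rightarrow> 'f) \<Rightarrow> ('f \<Rightarrow> 'm) \<Rightarrow> bool" where
  "permutation_presentation G M F i p \<longleftrightarrow>
    permutation_module G F \<and>
    i \<in> left_module_hom (group_ring G) F F \<and>
    p \<in> left_module_hom (group_ring G) F M \<and>
    inj_on i (carrier F) \<and>
    i ` carrier F = a_kernel F M p \<and>
    p ` carrier F = carrier M"

end

theory Submission
  imports Defs
begin

text \<open>
  The argument is a closing-off (Loewenheim-Skolem) argument on a permuted basis \<open>B\<close> of \<open>F\<close>.
  For \<open>C \<subseteq> B\<close>, its \<open>\<int>\<close>-span \<open>S\<close> carries a presentation of \<open>M\<close> by restriction of \<open>i\<close> and \<open>p\<close>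
  as soon as \<open>S\<close> is closed under the following maps \<open>F \<rightarrow> F\<close>: the scalars (so that \<open>S\<close> is a
  submodule), the map \<open>i\<close> (so that it restricts), the inverse of \<open>i\<close> on its image, extended by zero
  (so that an element of \<open>S\<close> killed by \<open>p\<close> is \<open>i s\<close> with \<open>s\<close> in \<open>S\<close> and not only in \<open>F\<close>), and, for
  each \<open>m\<close> in \<open>M\<close>, the constant map onto a chosen preimage of \<open>m\<close> (so that \<open>p\<close> stays surjective).
  These maps are countably many because the group ring and \<open>M\<close> are countable, and the span of a
  countable set is countable. So \<open>C\<close> can be found countable, by adding in \<open>\<omega>\<close> rounds the
  finitely many basis elements that each new value involves (\<open>countable_closed_subbasis\<close>).

  A translate of an element of \<open>C\<close> lies both in \<open>B\<close> and in the span of \<open>C\<close>, hence in \<open>C\<close> by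
  linear independence. Thus closure of the span under scalars makes the group permute \<open>C\<close>, and
  \<open>S\<close> is a permutation module (\<open>permutation_module_vimage\<close>).
  Finally \<open>S\<close> is replaced by an isomorphic copy whose elements are natural numbers
  (\<open>countable_submodule_copy\<close>). An injective homomorphism \<open>h\<close> from the copy onto \<open>S\<close> is all that
  is used of it: basis, action and presentation are pulled back along \<open>h\<close>.
\<close>

section \<open>Integral combinations and spans\<close>

lemma countable_keys_subset:
  assumes "countable C"
  shows "countable {c :: 'a \<Rightarrow>\<^sub>0 int. Poly_Mapping.keys c \<subseteq> C}"
proof -
  let ?graph = "\<lambda>c :: 'a \<Rightarrow>\<^sub>0 int. (\<lambda>b. (b, Poly_Mapping.lookup c b)) ` Poly_Mapping.keys c"
  have "inj ?graph"
  proof (rule injI)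
    fix c d :: "'a \<Rightarrow>\<^sub>0 int"
    assume eq: "?graph c = ?graph d"
    have graph: "(b, k) \<in> ?graph e \<longleftrightarrow> k \<noteq> 0 \<and> Poly_Mapping.lookup e b = k"
      for e :: "'a \<Rightarrow>\<^sub>0 int" and b k
      by (auto simp: in_keys_iff)
    show "c = d"
    proof (rule poly_mapping_eqI)
      fix b
      show "Poly_Mapping.lookup c b = Poly_Mapping.lookup d b"
        using graph[of b "Poly_Mapping.lookup c b" c] graph[of b "Poly_Mapping.lookup c b" d]
          graph[of b "Poly_Mapping.lookup d b" c] graph[of b "Poly_Mapping.lookup d b" d] eq
        by metis
    qed
  qed
  moreover have "countable (?graph ` {c. Poly_Mapping.keys c \<subseteq> C})"
  proof (rule countable_subset)
    show "countable {X. finite X \<and> X \<subseteq> C \<times> (UNIV :: int set)}"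
      using assms by (intro countable_Collect_finite_subset) auto
  qed auto
  ultimately show ?thesis
    using countable_image_inj_on inj_on_subset by blast
qed

definition int_span :: "('m, 'z) ring_scheme \<Rightarrow> 'm set \<Rightarrow> 'm set" where
  "int_span A B = int_comb A ` {c. Poly_Mapping.keys c \<subseteq> B}"

lemma int_spanI: "Poly_Mapping.keys c \<subseteq> B \<Longrightarrow> int_comb A c \<in> int_span A B"
  by (auto simp: int_span_def)

lemma countable_int_span: "countable B \<Longrightarrow> countable (int_span A B)"
  unfolding int_span_def by (intro countable_image countable_keys_subset)

lemma (in abelian_group) int_comb_superset:
  assumes "finite U" "Poly_Mapping.keys c \<subseteq> U" "U \<subseteq> carrier G"
  shows "int_comb G c = (\<Oplus>b\<in>U. [Poly_Mapping.lookup c b] \<cdot> b)"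
proof -
  have "add_pow G (0 :: int) b = \<zero>" for b
    by (simp add: add_pow_def)
  then show ?thesis
    unfolding int_comb_def using assms
    by (intro add.finprod_mono_neutral_cong_left) (auto simp: in_keys_iff)
qed

lemma (in abelian_group) int_comb_closed:
  "Poly_Mapping.keys c \<subseteq> carrier G \<Longrightarrow> int_comb G c \<in> carrier G"
  unfolding int_comb_def by (intro finsum_closed) auto

lemma (in abelian_group) int_comb_0: "int_comb G 0 = \<zero>"
  by (simp add: int_comb_def)

lemma (in abelian_group) int_comb_frag_of: "b \<in> carrier G \<Longrightarrow> int_comb G (frag_of b) = b"
  by (simp add: int_comb_def)

lemma (in abelian_group) int_comb_add:
  assumes "Poly_Mapping.keys c \<subseteq> carrier G" "Poly_Mapping.keys d \<subseteq> carrier G"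
  shows "int_comb G (c + d) = int_comb G c \<oplus> int_comb G d"
proof -
  let ?U = "Poly_Mapping.keys c \<union> Poly_Mapping.keys d"
  have "int_comb G (c + d) =
      (\<Oplus>b\<in>?U. [Poly_Mapping.lookup c b] \<cdot> b \<oplus> [Poly_Mapping.lookup d b] \<cdot> b)"
    using assms Poly_Mapping.keys_add[of c d]
    by (subst int_comb_superset[of ?U])
       (auto simp: lookup_add intro!: add.finprod_cong' add.int_pow_mult)
  also have "\<dots> = (\<Oplus>b\<in>?U. [Poly_Mapping.lookup c b] \<cdot> b) \<oplus> (\<Oplus>b\<in>?U. [Poly_Mapping.lookup d b] \<cdot> b)"
    using assms by (intro finsum_addf) auto
  also have "\<dots> = int_comb G c \<oplus> int_comb G d"
    using assms by (simp add: int_comb_superset[of ?U])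
  finally show ?thesis .
qed

lemma (in abelian_group) int_comb_minus:
  assumes "Poly_Mapping.keys c \<subseteq> carrier G"
  shows "int_comb G (- c) = \<ominus> int_comb G c"
proof -
  have "int_comb G (- c) \<oplus> int_comb G c = \<zero>"
    using assms int_comb_add[of "- c" c] by (simp add: int_comb_0)
  then show ?thesis
    using assms by (intro minus_equality[symmetric]) (simp_all add: int_comb_closed)
qed

lemma (in abelian_group) int_comb_diff:
  assumes "Poly_Mapping.keys c \<subseteq> carrier G" "Poly_Mapping.keys d \<subseteq> carrier G"
  shows "int_comb G (c - d) = int_comb G c \<ominus> int_comb G d"
  using assms int_comb_add[of c "- d"] by (simp add: int_comb_minus a_minus_def)

lemma (in abelian_group) int_span_subset: "B \<subseteq> carrier G \<Longrightarrow> int_span G B \<subseteq> carrier G"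
  by (auto simp: int_span_def intro: int_comb_closed)

lemma (in abelian_group) additive_subgroup_int_span:
  assumes "B \<subseteq> carrier G"
  shows "additive_subgroup (int_span G B) G"
proof (intro additive_subgroup.intro subgroup.intro)
  show "int_span G B \<subseteq> carrier (add_monoid G)"
    using int_span_subset assms by simp
next
  fix x y assume "x \<in> int_span G B" "y \<in> int_span G B"
  then obtain c d where "Poly_Mapping.keys c \<subseteq> B" "x = int_comb G c"
      "Poly_Mapping.keys d \<subseteq> B" "y = int_comb G d"
    by (auto simp: int_span_def)
  then show "x \<otimes>\<^bsub>add_monoid G\<^esub> y \<in> int_span G B"
    using assms int_comb_add[of c d] Poly_Mapping.keys_add[of c d] int_spanI[of "c + d" B G]
    by auto
next
  show "\<one>\<^bsub>add_monoid G\<^esub> \<in> int_span G B"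
    using int_spanI[of 0 B G] by (simp add: int_comb_0)
next
  fix x assume "x \<in> int_span G B"
  then obtain c where "Poly_Mapping.keys c \<subseteq> B" "x = int_comb G c"
    by (auto simp: int_span_def)
  then show "inv\<^bsub>add_monoid G\<^esub> x \<in> int_span G B"
    using assms int_comb_minus[of c] int_spanI[of "- c" B G] by (simp add: a_inv_def)
qed

text \<open>
  If \<open>b\<close> is the combination with coefficients \<open>c\<close>, then \<open>frag_of b - c\<close> is a relation between
  elements of \<open>B\<close>, hence trivial. This is what makes the group act on a subset of a permuted
  basis as soon as it acts on the span of that subset.
\<close>

lemma (in abelian_group) basis_mem_int_span:
  assumes "int_basis G B" "C \<subseteq> B" "b \<in> B" "b \<in> int_span G C"
  shows "b \<in> C"
proof -
  have B: "B \<subseteq> carrier G"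
    using assms(1) by (simp add: int_basis_def)
  obtain c where c: "Poly_Mapping.keys c \<subseteq> C" "b = int_comb G c"
    using assms(4) by (auto simp: int_span_def)
  have "int_comb G (frag_of b - c) = \<zero>"
    using c assms B int_comb_diff[of "frag_of b" c]
    by (auto simp: int_comb_frag_of a_minus_def r_neg subset_iff)
  moreover have "Poly_Mapping.keys (frag_of b - c) \<subseteq> B"
    using c(1) assms keys_diff[of "frag_of b" c] by auto
  ultimately have "frag_of b - c = 0"
    using assms(1) unfolding int_basis_def by blast
  then have "c = frag_of b" by simp
  then show ?thesis using c(1) by simp
qed

section \<open>Closing off a subset of a basis\<close>

text \<open>
  Start with the empty set and add, in each of \<open>\<omega>\<close> rounds, the support of every \<open>\<phi> x\<close> with \<open>x\<close> in
  the span reached so far. Each round adds countably many basis elements, and any element of the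
  span of the union is already in the span of some round, since its support is finite.
  Constant maps are allowed in \<open>\<Phi>\<close>; they serve to put prescribed elements into the span.
\<close>

lemma (in abelian_group) countable_closed_subbasis:
  assumes "int_basis G B" "countable \<Phi>" "\<Phi> \<subseteq> carrier G \<rightarrow> carrier G"
  obtains C where "C \<subseteq> B" "countable C" "\<forall>\<phi>\<in>\<Phi>. \<phi> ` int_span G C \<subseteq> int_span G C"
proof
  define coef where "coef x = (SOME c. Poly_Mapping.keys c \<subseteq> B \<and> x = int_comb G c)" for x
  have coef: "Poly_Mapping.keys (coef x) \<subseteq> B" "x = int_comb G (coef x)" if "x \<in> carrier G" for x
  proof -
    have "\<exists>c. Poly_Mapping.keys c \<subseteq> B \<and> x = int_comb G c"
      using assms(1) that by (simp add: int_basis_def)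
    from someI_ex[OF this] show "Poly_Mapping.keys (coef x) \<subseteq> B" "x = int_comb G (coef x)"
      by (simp_all add: coef_def)
  qed
  define step where "step D = D \<union> (\<Union>\<phi>\<in>\<Phi>. \<Union>x\<in>int_span G D. Poly_Mapping.keys (coef (\<phi> x)))" for D
  define D where "D n = (step ^^ n) {}" for n
  define C where "C = (\<Union>n. D n)"
  have D_Suc: "D (Suc n) = step (D n)" for n
    by (simp add: D_def)
  have D_B: "D n \<subseteq> B" for n
  proof (induction n)
    case (Suc n)
    then have "int_span G (D n) \<subseteq> carrier G"
      using assms(1) by (intro int_span_subset) (auto simp: int_basis_def)
    then show ?case
      using Suc coef(1) assms(3) unfolding D_Suc step_def by blast
  qed (simp add: D_def)
  have D_countable: "countable (D n)" for n
  proof (induction n)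
    case (Suc n)
    then show ?case
      unfolding D_Suc step_def
      by (intro countable_Un countable_UN assms countable_int_span) (auto intro: countable_finite)
  qed (simp add: D_def)
  have D_mono: "D m \<subseteq> D n" if "m \<le> n" for m n
    by (rule lift_Suc_mono_le[of D, OF _ that]) (auto simp: D_Suc step_def)
  show "C \<subseteq> B" "countable C"
    using D_B D_countable by (auto simp: C_def)
  show "\<forall>\<phi>\<in>\<Phi>. \<phi> ` int_span G C \<subseteq> int_span G C"
  proof (intro ballI image_subsetI)
    fix \<phi> x assume \<phi>: "\<phi> \<in> \<Phi>" and "x \<in> int_span G C"
    then obtain c where c: "Poly_Mapping.keys c \<subseteq> C" "x = int_comb G c"
      by (auto simp: int_span_def)
    have finite_C: "\<exists>n. K \<subseteq> D n" if "finite K" "K \<subseteq> C" for K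
      using that
    proof (induction K)
      case (insert b K)
      then obtain m n where "K \<subseteq> D m" "b \<in> D n" by (auto simp: C_def)
      then have "insert b K \<subseteq> D (max m n)"
        using D_mono[of m "max m n"] D_mono[of n "max m n"] by auto
      then show ?case ..
    qed simp
    then obtain n where "Poly_Mapping.keys c \<subseteq> D n"
      using finite_C[OF finite_keys c(1)] by blast
    then have x: "x \<in> int_span G (D n)"
      unfolding c(2) by (rule int_spanI)
    then have "Poly_Mapping.keys (coef (\<phi> x)) \<subseteq> D (Suc n)"
      using \<phi> unfolding D_Suc step_def by blast
    then have "Poly_Mapping.keys (coef (\<phi> x)) \<subseteq> C"
      by (auto simp: C_def)
    moreover have "\<phi> x \<in> carrier G"
    proof -
      have "int_span G (D n) \<subseteq> carrier G"
        using assms(1) D_B[of n] by (intro int_span_subset) (auto simp: int_basis_def)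
      then show ?thesis
        using x \<phi> assms(3) by blast
    qed
    ultimately show "\<phi> x \<in> int_span G C"
      using coef(2)[of "\<phi> x"] int_spanI[of "coef (\<phi> x)" C G] by metis
  qed
qed

section \<open>Pulling structure back along an injective homomorphism\<close>

lemma hom_int_comb:
  assumes "abelian_group A" "abelian_group A'"
    and h: "h \<in> carrier A \<rightarrow> carrier A'"
    and add: "\<And>x y. x \<in> carrier A \<Longrightarrow> y \<in> carrier A \<Longrightarrow> h (x \<oplus>\<^bsub>A\<^esub> y) = h x \<oplus>\<^bsub>A'\<^esub> h y"
    and "Poly_Mapping.keys c \<subseteq> carrier A"
  shows "h (int_comb A c) = int_comb A' (frag_extend (frag_of \<circ> h) c)"
proof -
  interpret A: abelian_group A by fact
  interpret A': abelian_group A' by fact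
  interpret abelian_group_hom A A' h
    using h add by (intro abelian_group_homI group_hom.intro A.a_group A'.a_group assms)
      (auto simp: group_hom_axioms_def hom_def)
  have keys: "Poly_Mapping.keys (frag_extend (frag_of \<circ> h) d) \<subseteq> carrier A'"
    if "Poly_Mapping.keys d \<subseteq> carrier A" for d
    using that keys_frag_extend[of "frag_of \<circ> h" d] h by fastforce
  have "Poly_Mapping.keys c \<subseteq> carrier A \<and> h (int_comb A c) = int_comb A' (frag_extend (frag_of \<circ> h) c)"
    using assms(5)
  proof (induction c rule: frag_induction)
    case (diff a b)
    then have "h (int_comb A (a - b)) = h (int_comb A a) \<ominus>\<^bsub>A'\<^esub> h (int_comb A b)"
      by (simp add: A.int_comb_diff A.int_comb_closed a_minus_def)
    also have "\<dots> = int_comb A' (frag_extend (frag_of \<circ> h) (a - b))"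
      using diff keys[of a] keys[of b] by (simp add: A'.int_comb_diff frag_extend_diff del: o_apply)
    finally have "h (int_comb A (a - b)) = int_comb A' (frag_extend (frag_of \<circ> h) (a - b))" .
    moreover have "Poly_Mapping.keys (a - b) \<subseteq> carrier A"
      using diff keys_diff[of a b] by blast
    ultimately show ?case by (intro conjI)
  qed (use h in \<open>auto simp: A.int_comb_0 A'.int_comb_0 A.int_comb_frag_of A'.int_comb_frag_of\<close>)
  then show ?thesis ..
qed

text \<open>
  Push-forward along \<open>h\<close> and along its inverse on \<open>C\<close> are mutually inverse between coefficient
  families on \<open>h -` C\<close> and on \<open>C\<close>, and \<open>h\<close> carries combinations to combinations; so spanning and
  independence transfer from \<open>C\<close>, which is independent as a part of \<open>B\<close>.
\<close>

lemma int_basis_vimage: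
  assumes A: "abelian_group A" and A': "abelian_group A'"
    and h: "h \<in> carrier A \<rightarrow> carrier A'"
    and add: "\<And>x y. x \<in> carrier A \<Longrightarrow> y \<in> carrier A \<Longrightarrow> h (x \<oplus>\<^bsub>A\<^esub> y) = h x \<oplus>\<^bsub>A'\<^esub> h y"
    and inj: "inj_on h (carrier A)"
    and basis: "int_basis A' B" and "C \<subseteq> B"
    and span: "h ` carrier A = int_span A' C"
  shows "int_basis A {x \<in> carrier A. h x \<in> C}"
  unfolding int_basis_def
proof (intro conjI ballI allI impI)
  interpret A: abelian_group A by fact
  interpret A': abelian_group A' by fact
  let ?D = "{x \<in> carrier A. h x \<in> C}"
  let ?k = "inv_into (carrier A) h"
  let ?h = "frag_extend (frag_of \<circ> h)"
  have C: "C \<subseteq> carrier A'"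
    using basis \<open>C \<subseteq> B\<close> by (auto simp: int_basis_def)
  have "C \<subseteq> int_span A' C"
  proof
    fix b assume "b \<in> C"
    then show "b \<in> int_span A' C"
      using int_spanI[of "frag_of b" C A'] C by (auto simp: A'.int_comb_frag_of)
  qed
  then have k: "?k b \<in> ?D" "h (?k b) = b" if "b \<in> C" for b
    using that span by (auto simp: inv_into_into f_inv_into_f)
  show "?D \<subseteq> carrier A" by auto
  show "\<exists>c. Poly_Mapping.keys c \<subseteq> ?D \<and> x = int_comb A c" if x: "x \<in> carrier A" for x
  proof -
    obtain d where d: "Poly_Mapping.keys d \<subseteq> C" "h x = int_comb A' d"
      using x span by (auto simp: int_span_def)
    let ?c = "frag_extend (frag_of \<circ> ?k) d"
    have c: "Poly_Mapping.keys ?c \<subseteq> ?D"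
      using keys_frag_extend[of "frag_of \<circ> ?k" d] d(1) k by fastforce
    have "?h ?c = d"
      using d(1) by (induction d rule: frag_induction) (auto simp: frag_extend_diff k)
    then have "h (int_comb A ?c) = h x"
      using c d hom_int_comb[OF A A' h add, of ?c] by (simp add: subset_iff)
    then have "int_comb A ?c = x"
      using inj x c by (auto intro!: A.int_comb_closed dest: inj_onD)
    then show ?thesis using c by blast
  qed
  show "c = 0" if c: "Poly_Mapping.keys c \<subseteq> ?D \<and> int_comb A c = \<zero>\<^bsub>A\<^esub>" for c
  proof -
    have "int_comb A' (?h c) = h (int_comb A c)"
      using c by (subst hom_int_comb[OF A A' h add]) auto
    also have "\<dots> = h (int_comb A 0)"
      using c by (simp add: A.int_comb_0)
    also have "\<dots> = \<zero>\<^bsub>A'\<^esub>"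
      by (subst hom_int_comb[OF A A' h add]) (auto simp: A'.int_comb_0)
    finally have "int_comb A' (?h c) = \<zero>\<^bsub>A'\<^esub>" .
    moreover have "Poly_Mapping.keys (?h c) \<subseteq> B"
      using keys_frag_extend[of "frag_of \<circ> h" c] c \<open>C \<subseteq> B\<close> by fastforce
    ultimately have "?h c = 0"
      using basis by (simp add: int_basis_def)
    moreover have "frag_extend (frag_of \<circ> ?k) (?h c) = c"
      using c[THEN conjunct1]
      by (induction c rule: frag_induction) (auto simp: frag_extend_diff inj)
    ultimately show "c = 0" by (metis frag_extend_0)
  qed
qed

text \<open>
  The operations are those of \<open>F\<close>, conjugated by an enumeration of \<open>S\<close>; the homomorphism \<open>h\<close> is the
  inverse of the enumeration.
\<close>

lemma countable_submodule_copy: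
  fixes F :: "('r, 'f, 'y) module_scheme"
  assumes "left_module R F" "additive_subgroup S F" "countable S"
    and smult: "\<And>a x. a \<in> carrier R \<Longrightarrow> x \<in> S \<Longrightarrow> a \<odot>\<^bsub>F\<^esub> x \<in> S"
  obtains N :: "('r, nat) module" and h
  where "left_module R N" "h \<in> left_module_hom R N F" "inj_on h (carrier N)" "h ` carrier N = S"
proof
  interpret F: left_module R F by fact
  interpret S: additive_subgroup S F by fact
  let ?e = "to_nat_on S" and ?d = "from_nat_into S"
  \<comment> \<open>\<open>mult\<close> and \<open>one\<close> come with the record type and have no meaning for a module\<close>
  define N :: "('r, nat) module" where "N =
    \<lparr>carrier = ?e ` S, mult = (\<lambda>x y. 0), one = 0, zero = ?e \<zero>\<^bsub>F\<^esub>,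
     add = (\<lambda>x y. ?e (?d x \<oplus>\<^bsub>F\<^esub> ?d y)), smult = (\<lambda>a x. ?e (a \<odot>\<^bsub>F\<^esub> ?d x))\<rparr>"
  have S: "x \<in> carrier F" if "x \<in> S" for x
    using S.a_subset that by auto
  have de: "?d (?e x) = x" if "x \<in> S" for x
    using that \<open>countable S\<close> by simp
  note simps = S de S.a_closed S.zero_closed smult
  have "abelian_group N"
  proof (rule abelian_groupI)
    fix x assume "x \<in> carrier N"
    then obtain s where s: "s \<in> S" "x = ?e s" by (auto simp: N_def)
    then show "\<exists>y\<in>carrier N. y \<oplus>\<^bsub>N\<^esub> x = \<zero>\<^bsub>N\<^esub>"
      by (intro bexI[of _ "?e (\<ominus>\<^bsub>F\<^esub> s)"]) (auto simp: N_def simps F.l_neg)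
  qed (auto simp: N_def simps F.a_ac)
  then show "left_module R N"
    by (intro left_module.intro left_module_axioms.intro F.ring_axioms)
       (auto simp: N_def simps F.smult_l_distr F.smult_r_distr F.smult_assoc F.smult_one)
  show "?d \<in> left_module_hom R N F"
    by (auto simp: left_module_hom_def N_def simps)
  show "inj_on ?d (carrier N)"
    by (auto simp: inj_on_def N_def simps)
  show "?d ` carrier N = S"
    by (force simp: N_def simps image_image)
qed

text \<open>
  The group maps \<open>C\<close> into \<open>B\<close>, because it permutes \<open>B\<close>, and into the span of \<open>C\<close>, because this span
  is the image of a module. The intersection is \<open>C\<close> by independence, and then \<open>g\<close> and its inverse
  act on the preimage of \<open>C\<close> as mutually inverse maps.
\<close>

lemma permutation_module_vimage:
  assumes G: "group G" and F: "left_module (group_ring G) F" and N: "left_module (group_ring G) N"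
    and basis: "int_basis F B"
    and perm: "\<And>g. g \<in> carrier G \<Longrightarrow> bij_betw (\<lambda>b. frag_of g \<odot>\<^bsub>F\<^esub> b) B B"
    and "C \<subseteq> B"
    and h: "h \<in> left_module_hom (group_ring G) N F" "inj_on h (carrier N)"
    and span: "h ` carrier N = int_span F C"
  shows "permutation_module G N"
proof -
  interpret G: group G by fact
  interpret F: left_module "group_ring G" F by fact
  interpret N: left_module "group_ring G" N by fact
  let ?D = "{x \<in> carrier N. h x \<in> C}"
  have ring: "frag_of g \<in> carrier (group_ring G)" if "g \<in> carrier G" for g
    using that by (simp add: group_ring_def)
  have h_smult: "h (frag_of g \<odot>\<^bsub>N\<^esub> x) = frag_of g \<odot>\<^bsub>F\<^esub> h x"
    if "g \<in> carrier G" "x \<in> carrier N" for g x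
    using h(1) ring that by (simp add: left_module_hom_def)
  have closed: "frag_of g \<odot>\<^bsub>N\<^esub> x \<in> ?D" if g: "g \<in> carrier G" and x: "x \<in> ?D" for g x
  proof -
    have "frag_of g \<odot>\<^bsub>N\<^esub> x \<in> carrier N"
      using g x ring by (simp add: N.smult_closed)
    moreover have "frag_of g \<odot>\<^bsub>F\<^esub> h x \<in> B"
      using perm[OF g] x \<open>C \<subseteq> B\<close> by (auto simp: bij_betw_def)
    moreover have "frag_of g \<odot>\<^bsub>F\<^esub> h x \<in> int_span F C"
      using span calculation(1) h_smult[OF g, of x] x by (metis (lifting) imageI mem_Collect_eq)
    ultimately show ?thesis
      using F.basis_mem_int_span[OF basis \<open>C \<subseteq> B\<close>] h_smult[OF g, of x] x by auto
  qed
  have inverse: "frag_of g \<odot>\<^bsub>N\<^esub> (frag_of g' \<odot>\<^bsub>N\<^esub> x) = x"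
    if "g \<in> carrier G" "g' \<in> carrier G" "g \<otimes>\<^bsub>G\<^esub> g' = \<one>\<^bsub>G\<^esub>" "x \<in> carrier N" for g g' x
    using that ring N.smult_assoc[of "frag_of g" "frag_of g'" x] N.smult_one[of x]
    by (simp add: group_ring_def)
  have "bij_betw (\<lambda>x. frag_of g \<odot>\<^bsub>N\<^esub> x) ?D ?D" if g: "g \<in> carrier G" for g
    using g closed[of g] closed[of "inv\<^bsub>G\<^esub> g"]
    by (intro bij_betwI[where g = "\<lambda>x. frag_of (inv\<^bsub>G\<^esub> g) \<odot>\<^bsub>N\<^esub> x"]) (auto simp: inverse)
  moreover have "int_basis N ?D"
    using h basis \<open>C \<subseteq> B\<close> span
    by (intro int_basis_vimage[of N F h B])
       (auto simp: left_module_hom_def intro: F.abelian_group_axioms N.abelian_group_axioms)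
  ultimately show ?thesis
    using N by (auto simp: permutation_module_def)
qed

section \<open>Countable permutation presentations\<close>

theorem proposition1p3:
  fixes \<Gamma> :: "('g, 'z) monoid_scheme"
    and M :: "('g \<Rightarrow>\<^sub>0 int, 'm, 'y) module_scheme"
  assumes "group \<Gamma>" and "finite (carrier \<Gamma>)"
    and "left_module (group_ring \<Gamma>) M" and "countable (carrier M)"
    and "\<exists>(F :: ('g \<Rightarrow>\<^sub>0 int, 'f) module) i p. permutation_presentation \<Gamma> M F i p"
  shows "\<exists>(F :: ('g \<Rightarrow>\<^sub>0 int, nat) module) i p.
    permutation_presentation \<Gamma> M F i p \<and> countable (carrier F)"
proof -
  let ?R = "group_ring \<Gamma>"
  obtain F :: "('g \<Rightarrow>\<^sub>0 int, 'f) module" and i p where pres: "permutation_presentation \<Gamma> M F i p"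
    using assms(5) by blast
  then obtain B where F: "left_module ?R F" and basis: "int_basis F B"
    and perm: "\<And>g. g \<in> carrier \<Gamma> \<Longrightarrow> bij_betw (\<lambda>b. frag_of g \<odot>\<^bsub>F\<^esub> b) B B"
    by (auto simp: permutation_presentation_def permutation_module_def)
  from pres have i: "i \<in> left_module_hom ?R F F" and p: "p \<in> left_module_hom ?R F M"
    and inj_i: "inj_on i (carrier F)" and surj_p: "p ` carrier F = carrier M"
    and ker: "\<And>x. x \<in> i ` carrier F \<longleftrightarrow> x \<in> carrier F \<and> p x = \<zero>\<^bsub>M\<^esub>"
    by (auto simp: permutation_presentation_def a_kernel_def')
  interpret F: left_module ?R F by fact
  have i_closed: "i x \<in> carrier F" if "x \<in> carrier F" for x
    using i that by (auto simp: left_module_hom_def)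
  define j where "j x = (if x \<in> i ` carrier F then inv_into (carrier F) i x else \<zero>\<^bsub>F\<^esub>)" for x
  define s where "s = inv_into (carrier F) p"
  have s: "s m \<in> carrier F" "p (s m) = m" if "m \<in> carrier M" for m
    using that surj_p by (auto simp: s_def inv_into_into f_inv_into_f)
  \<comment> \<open>the self-maps of \<open>F\<close> under which the span has to be closed to inherit the presentation\<close>
  define \<Phi> where "\<Phi> = {i, j} \<union> (\<lambda>a x. a \<odot>\<^bsub>F\<^esub> x) ` carrier ?R \<union> (\<lambda>m x. s m) ` carrier M"
  have "countable (carrier ?R)"
    using assms(2) by (simp add: group_ring_def countable_keys_subset countable_finite)
  then have "countable \<Phi>"
    using assms(4) by (simp add: \<Phi>_def)
  moreover have "\<Phi> \<subseteq> carrier F \<rightarrow> carrier F"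
    using i_closed s by (auto simp: \<Phi>_def j_def F.smult_closed inv_into_into)
  ultimately obtain C where C: "C \<subseteq> B" "countable C"
      "\<forall>\<phi>\<in>\<Phi>. \<phi> ` int_span F C \<subseteq> int_span F C"
    using F.countable_closed_subbasis[OF basis] by blast
  define S where "S = int_span F C"
  have C_carrier: "C \<subseteq> carrier F"
    using C(1) basis by (auto simp: int_basis_def)
  then have S_sub: "additive_subgroup S F"
    unfolding S_def by (rule F.additive_subgroup_int_span)
  then interpret S: additive_subgroup S F .
  have S_countable: "countable S"
    unfolding S_def using C(2) by (rule countable_int_span)
  have S_F: "x \<in> carrier F" if "x \<in> S" for x
    using that S.a_subset by auto
  have \<Phi>_S: "\<phi> x \<in> S" if "\<phi> \<in> \<Phi>" "x \<in> S" for \<phi> x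
    using C(3) that by (auto simp: S_def)
  have i_S: "i x \<in> S" and j_S: "j x \<in> S" if "x \<in> S" for x
    using that \<Phi>_S[of i x] \<Phi>_S[of j x] by (auto simp: \<Phi>_def)
  have smult_S: "a \<odot>\<^bsub>F\<^esub> x \<in> S" if "a \<in> carrier ?R" "x \<in> S" for a x
    by (rule \<Phi>_S[where \<phi> = "\<lambda>x. a \<odot>\<^bsub>F\<^esub> x"]) (use that in \<open>auto simp: \<Phi>_def\<close>)
  \<comment> \<open>\<open>s m\<close> is the value at zero of one of the constant maps in \<open>\<Phi>\<close>\<close>
  have s_S: "s m \<in> S" if "m \<in> carrier M" for m
    by (rule \<Phi>_S[where \<phi> = "\<lambda>x. s m" and x = "\<zero>\<^bsub>F\<^esub>"]) (use that in \<open>auto simp: \<Phi>_def\<close>)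
  obtain N :: "('g \<Rightarrow>\<^sub>0 int, nat) module" and h where N: "left_module ?R N"
    and h: "h \<in> left_module_hom ?R N F" "inj_on h (carrier N)" "h ` carrier N = S"
    by (rule countable_submodule_copy[OF F S_sub S_countable smult_S])
  interpret N: left_module ?R N by fact
  define i' where "i' x = inv_into (carrier N) h (i (h x))" for x
  have h_S: "h x \<in> S" if "x \<in> carrier N" for x
    using that h(3) by auto
  have i': "i' x \<in> carrier N" "h (i' x) = i (h x)" if "x \<in> carrier N" for x
    using that i_S[OF h_S] h(3) by (auto simp: i'_def inv_into_into f_inv_into_f)
  have eqI: "x = y" if "h x = h y" "x \<in> carrier N" "y \<in> carrier N" for x y
    using h(2) that by (auto simp: inj_on_def)
  have "permutation_module \<Gamma> N"
    using permutation_module_vimage[OF assms(1) F N basis perm C(1) h(1,2)] h(3) S_def by simp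
  moreover have "i' \<in> left_module_hom ?R N N"
    unfolding left_module_hom_def
  proof (safe intro!: eqI)
  qed (use i h(1) in \<open>auto simp: i' left_module_hom_def Pi_iff N.smult_closed\<close>)
  moreover have "p \<circ> h \<in> left_module_hom ?R N M"
    using h(1) p by (auto simp: left_module_hom_def Pi_iff)
  moreover have "inj_on i' (carrier N)"
  proof (rule inj_onI)
    fix x y assume xy: "x \<in> carrier N" "y \<in> carrier N" "i' x = i' y"
    then have "i (h x) = i (h y)" using i'(2) by metis
    then show "x = y"
      using xy eqI inj_i S_F[OF h_S] by (auto simp: inj_on_def)
  qed
  moreover have "i' ` carrier N = a_kernel N M (p \<circ> h)"
    unfolding a_kernel_def'
  proof (intro equalityI subsetI)
    fix y assume "y \<in> i' ` carrier N"
    then obtain x where "x \<in> carrier N" "y = i' x" by blast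
    then show "y \<in> {x \<in> carrier N. (p \<circ> h) x = \<zero>\<^bsub>M\<^esub>}"
      using i' ker[of "i (h x)"] S_F[OF h_S] by auto
  next
    fix y assume y: "y \<in> {x \<in> carrier N. (p \<circ> h) x = \<zero>\<^bsub>M\<^esub>}"
    then have "h y \<in> i ` carrier F"
      using ker[of "h y"] S_F[OF h_S] by simp
    then have "i (j (h y)) = h y"
      by (simp add: j_def f_inv_into_f)
    moreover have "j (h y) \<in> h ` carrier N"
      using j_S[OF h_S] y h(3) by blast
    then obtain x where "x \<in> carrier N" "h x = j (h y)"
      by auto
    ultimately have "i' x = y" "x \<in> carrier N"
      using y i' by (auto intro: eqI)
    then show "y \<in> i' ` carrier N" by blast
  qed
  moreover have "(p \<circ> h) ` carrier N = carrier M"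
  proof -
    have "p ` S = carrier M"
    proof
      show "p ` S \<subseteq> carrier M"
        using S_F surj_p by blast
      show "carrier M \<subseteq> p ` S"
        using s(2) s_S by (metis image_eqI subsetI)
    qed
    then show ?thesis
      by (simp only: image_comp[symmetric] h(3))
  qed
  ultimately have "permutation_presentation \<Gamma> M N i' (p \<circ> h)"
    by (simp add: permutation_presentation_def)
  then show ?thesis by blast
qed

end
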